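(* Let $R$ be a unital commutative ring, $\mathcal A$ a commutative unital $R$-algebra, $D_1,\dots,D_n$ $R$-derivations of $\mathcal A$ (not assumed to commute), and $D=(D_1,\dots,D_n)$. Let $0\neq P(\xi)\in\mathcal A\langle\xi\rangle$ be a polynomial in $n$ noncommutative free variables $\xi=(\xi_1,\dots,\xi_n)$, written as $P(\xi)=a_0+\sum_{k=1}^d P_k(\xi)$ with $a_0\in\mathcal A$, $d\ge 1$ and $P_k(\xi)$ homogeneous of degree $k$ in $\xi$. Let $\operatorname{nil}(\mathcal A)$ be the set of all nilpotent elements of $\mathcal A$. Then the following statements hold: 1) $\mathfrak r(\operatorname{Ker}P(D))\subseteq\mathfrak r(\operatorname{Ann}(a_0))$, where $\operatorname{Ann}(a_0)=\{b\in\mathcal A: a_0b=0\}$; 2) if $a_0$ is not zero nor a zero-divisor of $\mathcal A$, then $\mathfrak r(\operatorname{Ker}P(D))=\operatorname{nil}(\mathcal A)$ and $\operatorname{Ker}P(D)$ is a Mathieu subspace of $\mathcal A$; 3) if $a_0=0$, then $$\mathfrak r(\operatorname{Ker}P(D))\subseteq\mathfrak r\big(\{u\in\mathcal A: d!\,P_d(\nabla u)=0\}\big).$$ In particular, if (still with $a_0=0$) $n=1$, i.e. $D$ is a single derivation of $\mathcal A$, and the leading coefficient of $P(\xi)$ is not a zero-divisor of $\mathcal A$, then $$\mathfrak r(\operatorname{Ker}P(D))\subseteq\mathfrak r\big(\{u\in\mathcal A: d!\,Du\in\operatorname{nil}(\mathcal A)\}\big).$$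
   Context: An $R$-derivation of $\mathcal A$ is an $R$-linear map $\delta:\mathcal A\to\mathcal A$ with $\delta(ab)=\delta(a)b+a\delta(b)$. $\mathcal A\langle\xi\rangle$ is the polynomial algebra over $\mathcal A$ in the noncommutative free variables $\xi_1,\dots,\xi_n$ (coefficients commute with the variables). For $u\in\mathcal A$, $\nabla u:=(D_1u,\dots,D_nu)$. The operator $P(D):\mathcal A\to\mathcal A$ and the element $P_d(\nabla u)\in\mathcal A$ are obtained by first writing all coefficients on the left of the monomials in $\xi$, and then replacing each $\xi_i$ by $D_i$ (products being compositions, coefficients acting by multiplication), respectively by $D_iu$. For a subset $V\subseteq\mathcal A$, its radical is $\mathfrak r(V):=\{a\in\mathcal A: a^m\in V\text{ for all sufficiently large } m\}$. An $R$-submodule $V$ of an $R$-algebra $\mathcal A$ is a Mathieu subspace of $\mathcal A$ if for all $a,b,c\in\mathcal A$ such that $a^m\in V$ for all $m\ge1$, there exists $N$ (depending on $a,b,c$) such that $ba^mc\in V$ for all $m\ge N$. *)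

theory Defs
  imports Complex_Main "HOL-Library.Poly_Mapping" "HOL-Library.Cardinality"
begin

text \<open>Since the algebra is commutative, this one compatibility law also gives
  \<open>scale r (a * b) = a * scale r b\<close>.\<close>

locale comm_alg = module scale
  for scale :: "'r::comm_ring_1 \<Rightarrow> 'a::comm_ring_1 \<Rightarrow> 'a" +
  assumes scale_mult_left: "scale r (a * b) = scale r a * b"

definition derivation ::
    "('r::comm_ring_1 \<Rightarrow> 'a::comm_ring_1 \<Rightarrow> 'a) \<Rightarrow> ('a \<Rightarrow> 'a) \<Rightarrow> bool" where
  "derivation scale \<delta> \<longleftrightarrow>
     module_hom scale scale \<delta> \<and> (\<forall>a b. \<delta> (a * b) = \<delta> a * b + a * \<delta> b)"

text \<open>Noncommutative polynomials in the variables \<open>\<xi>\<^sub>i\<close>, \<open>i :: 'n\<close>, are finitely supported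
  functions on words: the word \<open>[i\<^sub>1, \<dots>, i\<^sub>k]\<close> is the monomial \<open>\<xi>\<^bsub>i\<^sub>1\<^esub> \<cdots> \<xi>\<^bsub>i\<^sub>k\<^esub>\<close>, and
  \<open>lookup P w\<close> is its coefficient, written on the left. Only the additive structure of the
  polynomial algebra is needed below.\<close>

type_synonym ('n, 'a) ncpoly = "'n list \<Rightarrow>\<^sub>0 'a"

definition nc_const :: "'a \<Rightarrow> ('n, 'a::zero) ncpoly" where
  "nc_const a = Poly_Mapping.single [] a"

definition nc_homogeneous :: "nat \<Rightarrow> ('n, 'a::zero) ncpoly \<Rightarrow> bool" where
  "nc_homogeneous k Q \<longleftrightarrow> (\<forall>w \<in> Poly_Mapping.keys Q. length w = k)"

text \<open>Meaningful for nonzero polynomials only.\<close>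

definition nc_degree :: "('n, 'a::zero) ncpoly \<Rightarrow> nat" where
  "nc_degree P = Max (length ` Poly_Mapping.keys P)"

text \<open>For polynomials in the single variable \<open>\<xi>\<^sub>i\<close>, whose monomials are \<open>\<xi>\<^sub>i\<^sup>k = replicate k i\<close>.\<close>

definition nc_lead_coeff :: "'n \<Rightarrow> ('n, 'a::zero) ncpoly \<Rightarrow> 'a" where
  "nc_lead_coeff i P = Poly_Mapping.lookup P (replicate (nc_degree P) i)"

text \<open>\<open>P(D)\<close>: here \<open>foldr D [i\<^sub>1, \<dots>, i\<^sub>k] = D i\<^sub>1 \<circ> \<cdots> \<circ> D i\<^sub>k\<close>.\<close>

definition diff_op ::
    "('n, 'a::comm_ring_1) ncpoly \<Rightarrow> ('n \<Rightarrow> 'a \<Rightarrow> 'a) \<Rightarrow> 'a \<Rightarrow> 'a" where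
  "diff_op P D u =
     (\<Sum>w \<in> Poly_Mapping.keys P. Poly_Mapping.lookup P w * foldr D w u)"

definition nc_eval :: "('n, 'a::comm_ring_1) ncpoly \<Rightarrow> ('n \<Rightarrow> 'a) \<Rightarrow> 'a" where
  "nc_eval P v =
     (\<Sum>w \<in> Poly_Mapping.keys P. Poly_Mapping.lookup P w * prod_list (map v w))"

definition gradient :: "('n \<Rightarrow> 'a \<Rightarrow> 'a) \<Rightarrow> 'a \<Rightarrow> 'n \<Rightarrow> 'a" where
  "gradient D u = (\<lambda>i. D i u)"

definition Ker :: "('a \<Rightarrow> 'a::zero) \<Rightarrow> 'a set" where
  "Ker f = {u. f u = 0}"

definition Ann :: "'a::comm_ring_1 \<Rightarrow> 'a set" where
  "Ann a = {b. a * b = 0}"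

definition nilpotents :: "'a::comm_ring_1 set" where
  "nilpotents = {a. \<exists>m. a ^ m = 0}"

text \<open>By this definition \<open>0\<close> is a zero divisor.\<close>

definition zero_divisor :: "'a::comm_ring_1 \<Rightarrow> bool" where
  "zero_divisor a \<longleftrightarrow> (\<exists>b. b \<noteq> 0 \<and> a * b = 0)"

definition radical :: "'a::comm_ring_1 set \<Rightarrow> 'a set" where
  "radical V = {a. \<exists>N. \<forall>m\<ge>N. a ^ m \<in> V}"

definition mathieu_subspace ::
    "('r::comm_ring_1 \<Rightarrow> 'a::comm_ring_1 \<Rightarrow> 'a) \<Rightarrow> 'a set \<Rightarrow> bool" where
  "mathieu_subspace scale V \<longleftrightarrow>
     module.subspace scale V \<and>
     (\<forall>a b c. (\<forall>m\<ge>1. a ^ m \<in> V) \<longrightarrow> (\<exists>N. \<forall>m\<ge>N. b * a ^ m * c \<in> V))"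

end

theory Submission
  imports Defs
begin

text \<open>Write \<open>ad\<^sub>u L = [L, u]\<close> for an additive operator \<open>L\<close>. If \<open>P\<close> has degree at most \<open>e\<close>, then
  \<open>ad\<^sub>u\<^sup>e (P(D))\<close> is multiplication by \<open>e! P\<^sub>e(\<nabla>u)\<close> and \<open>ad\<^sub>u\<^sup>e\<^sup>+\<^sup>1 (P(D)) = 0\<close>, whether or not the
  derivations commute. If \<open>P(D)\<close> kills all large powers of \<open>u\<close>, then so does \<open>ad\<^sub>u\<^sup>e (P(D))\<close>, which
  gives \<open>e! P\<^sub>e(\<nabla>u) u\<^sup>m = 0\<close> for large \<open>m\<close>. Replacing \<open>u\<close> by a power, one may assume that
  \<open>P(D)\<close> kills all positive powers of \<open>u\<close>; evaluating \<open>ad\<^sub>u\<^sup>e\<^sup>+\<^sup>1 (P(D)) = 0\<close> at \<open>1\<close> then gives \<open>u\<^sup>e\<^sup>+\<^sup>1 a\<^sub>0 = 0\<close>.\<close>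

section \<open>Iterated commutators with multiplication by \<open>u\<close>\<close>

definition ad :: "'a::comm_ring_1 \<Rightarrow> ('a \<Rightarrow> 'a) \<Rightarrow> 'a \<Rightarrow> 'a" where
  "ad u L = (\<lambda>v. L (u * v) - u * L v)"

text \<open>A commutator evaluated at \<open>u ^ m\<close> involves the previous iterate only at
  \<open>u ^ m\<close> and \<open>u ^ Suc m\<close>, so vanishing from \<open>N\<close> on persists
  with the same \<open>N\<close>.\<close>

lemma ad_funpow_eq_0:
  assumes "\<And>m. m \<ge> N \<Longrightarrow> L (u ^ m) = 0" and "m \<ge> N"
  shows "(ad u ^^ k) L (u ^ m) = 0"
  using assms(2)
proof (induction k arbitrary: m)
  case (Suc k)
  then show ?case
    using Suc.IH[of m] Suc.IH[of "Suc m"] by (simp add: ad_def)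
qed (simp add: assms)

text \<open>At \<open>1\<close>, the term of the commutator that evaluates the previous iterate at
  \<open>u * 1\<close> vanishes by \<open>ad_funpow_eq_0\<close>, so each step only contributes a
  factor \<open>- u\<close>.\<close>

lemma ad_funpow_one:
  assumes "\<And>m. m \<ge> 1 \<Longrightarrow> L (u ^ m) = 0"
  shows "(ad u ^^ k) L 1 = (- u) ^ k * L 1"
proof (induction k)
  case (Suc k)
  then show ?case
    using ad_funpow_eq_0[of 1 L u 1 k] assms
    by (simp add: ad_def[of u "(ad u ^^ k) L"] mult.assoc)
qed simp

text \<open>Multiplications by \<open>c w\<close> and by \<open>u\<close> commute, so coefficients
  pass through \<open>ad u\<close>.\<close>

lemma ad_funpow_sum:
  "(ad u ^^ k) (\<lambda>v. \<Sum>w\<in>S. c w * L w v) = (\<lambda>v. \<Sum>w\<in>S. c w * (ad u ^^ k) (L w) v)"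
proof (induction k)
  case (Suc k)
  have "(ad u ^^ Suc k) (\<lambda>v. \<Sum>w\<in>S. c w * L w v) =
      ad u (\<lambda>v. \<Sum>w\<in>S. c w * (ad u ^^ k) (L w) v)"
    by (simp add: Suc.IH)
  also have "\<dots> = (\<lambda>v. \<Sum>w\<in>S. c w * ad u ((ad u ^^ k) (L w)) v)"
    by (simp add: ad_def[of u] right_diff_distrib sum_subtractf sum_distrib_left mult.left_commute)
  finally show ?case
    by simp
qed simp

section \<open>Elementary rules for derivations\<close>

lemma derivation_add: "derivation scale \<delta> \<Longrightarrow> \<delta> (a + b) = \<delta> a + \<delta> b"
  using module_hom.add[of scale scale \<delta> a b] by (simp add: derivation_def)

lemma derivation_scale: "derivation scale \<delta> \<Longrightarrow> \<delta> (scale r a) = scale r (\<delta> a)"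
  by (simp add: derivation_def module_hom.scale)

lemma derivation_mult: "derivation scale \<delta> \<Longrightarrow> \<delta> (a * b) = \<delta> a * b + a * \<delta> b"
  by (simp add: derivation_def)

lemma derivation_0: "derivation scale \<delta> \<Longrightarrow> \<delta> 0 = 0"
  using derivation_add[of scale \<delta> 0 0] by simp

lemma derivation_diff: "derivation scale \<delta> \<Longrightarrow> \<delta> (a - b) = \<delta> a - \<delta> b"
  using derivation_add[of scale \<delta> "a - b" b] by simp

lemma derivation_1: "derivation scale \<delta> \<Longrightarrow> \<delta> 1 = 0"
  using derivation_mult[of scale \<delta> 1 1] by simp

lemma derivation_power:
  assumes "derivation scale \<delta>"
  shows "\<delta> (u ^ m) = of_nat m * u ^ (m - 1) * \<delta> u"
proof (induction m)
  case (Suc m)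
  then show ?case
    by (cases m) (simp_all add: derivation_mult[OF assms] derivation_1[OF assms] algebra_simps)
qed (simp add: derivation_1[OF assms])

section \<open>Commutators of differential operators\<close>

text \<open>Leibniz rule for \<open>ad u\<close> on a composition: the commutator of
  \<open>\<delta>\<close> with \<open>u\<close> is multiplication by \<open>\<delta> u\<close>,
  whose own commutator is zero, so only two terms survive.\<close>

lemma ad_funpow_derivation_comp:
  assumes "derivation scale \<delta>"
  shows "(ad u ^^ k) (\<lambda>v. \<delta> (L v)) =
    (\<lambda>v. \<delta> ((ad u ^^ k) L v) + of_nat k * \<delta> u * (ad u ^^ (k - 1)) L v)"
proof (induction k)
  case (Suc k)
  define A where "A j = (ad u ^^ j) L" for j
  have A_Suc: "A (Suc j) v = A j (u * v) - u * A j v" for j v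
    by (simp add: A_def ad_def)
  \<comment> \<open>For \<open>k = 0\<close> the truncated \<open>k - 1\<close> does no harm because
    of the factor \<open>of_nat k\<close>.\<close>
  have lower: "of_nat k * (A (k - 1) (u * v) - u * A (k - 1) v) = of_nat k * A k v" for v
    by (cases k) (simp_all add: A_Suc)
  have "(ad u ^^ Suc k) (\<lambda>v. \<delta> (L v)) v = \<delta> (A k (u * v)) - u * \<delta> (A k v)
      + \<delta> u * (of_nat k * (A (k - 1) (u * v) - u * A (k - 1) v))" for v
    unfolding funpow.simps comp_apply Suc.IH by (simp add: ad_def A_def algebra_simps)
  also have "\<dots> v = \<delta> (A (Suc k) v) + of_nat (Suc k) * \<delta> u * A k v" for v
    unfolding lower A_Suc derivation_diff[OF assms] derivation_mult[OF assms]
    by (simp add: algebra_simps)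
  finally show ?case
    by (simp add: A_def fun_eq_iff del: funpow.simps)
qed simp

text \<open>Splitting off the first letter by \<open>ad_funpow_derivation_comp\<close> leaves two
  terms. The shorter word vanishes under \<open>k\<close> commutators; under \<open>k - 1\<close> of
  them it is again covered by induction, and the factor \<open>k * D i u\<close> completes the
  factorial and the product.\<close>

lemma ad_funpow_word:
  assumes "\<And>i. derivation scale (D i)"
  shows "length w \<le> k \<Longrightarrow> (ad u ^^ k) (foldr D w) v =
    (if length w = k then of_nat (fact k) * prod_list (map (gradient D u) w) * v else 0)"
proof (induction w arbitrary: k v)
  case Nil
  have "(ad u ^^ Suc j) (\<lambda>v. v) = (\<lambda>v. 0)" for j
    by (induction j) (auto simp: ad_def)
  then show ?case
    by (cases k) (auto simp: id_def simp del: funpow.simps(2))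
next
  case (Cons i w)
  obtain j where k: "k = Suc j" "length w \<le> j"
    using Cons.prems by (cases k) auto
  have "(ad u ^^ k) (\<lambda>v. D i (foldr D w v)) v =
      D i ((ad u ^^ k) (foldr D w) v) + of_nat k * D i u * (ad u ^^ j) (foldr D w) v"
    by (simp add: ad_funpow_derivation_comp[OF assms] k(1) del: funpow.simps)
  moreover have "(\<lambda>v. D i (foldr D w v)) = foldr D (i # w)"
    by (simp add: fun_eq_iff)
  ultimately show ?case
    using Cons.IH[of k v] Cons.IH[of j v] k
    by (simp add: derivation_0[OF assms] gradient_def algebra_simps del: funpow.simps)
qed

text \<open>The degree-\<open>e\<close> component of \<open>P\<close> evaluated at \<open>v\<close>.
  It is read off \<open>P\<close> itself, so that \<open>e\<close> can be the bound \<open>d\<close>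
  as well as the true degree.\<close>

definition symbol_at :: "nat \<Rightarrow> ('n, 'a::comm_ring_1) ncpoly \<Rightarrow> ('n \<Rightarrow> 'a) \<Rightarrow> 'a" where
  "symbol_at e P v = (\<Sum>w | w \<in> Poly_Mapping.keys P \<and> length w = e.
     Poly_Mapping.lookup P w * prod_list (map v w))"

text \<open>Under \<open>e\<close> commutators the words shorter than \<open>e\<close> vanish and
  those of length \<open>e\<close> become multiplications, which one more commutator kills.\<close>

lemma ad_funpow_diff_op:
  assumes "\<And>i. derivation scale (D i)"
    and "\<And>w. w \<in> Poly_Mapping.keys P \<Longrightarrow> length w \<le> e"
  shows "(ad u ^^ e) (diff_op P D) v = of_nat (fact e) * symbol_at e P (gradient D u) * v"
    and "(ad u ^^ Suc e) (diff_op P D) v = 0"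
proof -
  have expand: "(ad u ^^ k) (diff_op P D) v = (\<Sum>w\<in>Poly_Mapping.keys P.
      Poly_Mapping.lookup P w * (ad u ^^ k) (foldr D w) v)" for k
    using ad_funpow_sum[of k u "Poly_Mapping.lookup P" "foldr D" "Poly_Mapping.keys P"]
    by (simp add: diff_op_def[abs_def])
  show "(ad u ^^ Suc e) (diff_op P D) v = 0"
    unfolding expand
  proof (intro sum.neutral ballI)
    fix w assume "w \<in> Poly_Mapping.keys P"
    then have "length w \<le> e"
      by (rule assms(2))
    then show "Poly_Mapping.lookup P w * (ad u ^^ Suc e) (foldr D w) v = 0"
      by (simp add: ad_funpow_word[OF assms(1)] del: funpow.simps)
  qed
  have "(ad u ^^ e) (diff_op P D) v = (\<Sum>w\<in>Poly_Mapping.keys P. if length w = e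
      then Poly_Mapping.lookup P w * (of_nat (fact e) * prod_list (map (gradient D u) w) * v)
      else 0)"
    unfolding expand using assms(2)
    by (intro sum.cong refl) (simp add: ad_funpow_word[OF assms(1)])
  also have "\<dots> = (\<Sum>w | w \<in> Poly_Mapping.keys P \<and> length w = e.
      Poly_Mapping.lookup P w * (of_nat (fact e) * prod_list (map (gradient D u) w) * v))"
    by (simp only: sum.inter_filter finite_keys)
  finally show "(ad u ^^ e) (diff_op P D) v = of_nat (fact e) * symbol_at e P (gradient D u) * v"
    by (simp add: symbol_at_def sum_distrib_left sum_distrib_right
        mult.assoc mult.left_commute)
qed

section \<open>Powers of \<open>u\<close> in the kernel of \<open>P(D)\<close>\<close>

lemma symbol_at_power_eq_0:
  assumes "\<And>i. derivation scale (D i)"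
    and "\<And>w. w \<in> Poly_Mapping.keys P \<Longrightarrow> length w \<le> e"
    and "\<And>m. m \<ge> N \<Longrightarrow> u ^ m \<in> Ker (diff_op P D)"
    and "m \<ge> N"
  shows "of_nat (fact e) * symbol_at e P (gradient D u) * u ^ m = 0"
proof -
  have "(ad u ^^ e) (diff_op P D) (u ^ m) = 0"
    using ad_funpow_eq_0[of N "diff_op P D"] assms(3,4) by (auto simp: Ker_def)
  then show ?thesis
    by (simp add: ad_funpow_diff_op(1)[OF assms(1,2)])
qed

text \<open>Homogeneity of the symbol, used to pull the scalar of \<open>gradient_power\<close> out
  of it.\<close>

lemma symbol_at_scale:
  "symbol_at e P (\<lambda>i. c * v i) = c ^ e * symbol_at e P v"
proof -
  have "prod_list (map (\<lambda>i. c * v i) w) = c ^ length w * prod_list (map v w)" for w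
    by (induction w) (simp_all add: ac_simps)
  then show ?thesis
    by (simp add: symbol_at_def sum_distrib_left ac_simps)
qed

lemma gradient_power:
  assumes "\<And>i. derivation scale (D i)"
  shows "gradient D (u ^ m) = (\<lambda>i. of_nat m * u ^ (m - 1) * gradient D u i)"
  by (simp add: gradient_def derivation_power[OF assms])

text \<open>Derivations kill \<open>1\<close>, so only the empty word contributes; this is how the
  constant term enters.\<close>

lemma diff_op_1:
  assumes "\<And>i. derivation scale (D i)"
  shows "diff_op P D 1 = Poly_Mapping.lookup P []"
proof -
  have zero: "foldr D w 0 = 0" for w
    by (induction w) (simp_all add: derivation_0[OF assms])
  have one: "foldr D w 1 = (if w = [] then 1 else 0)" for w
    by (induction w) (simp_all add: derivation_0[OF assms] derivation_1[OF assms])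
  show ?thesis
    by (simp add: diff_op_def one if_distrib in_keys_iff cong: if_cong)
qed

lemma subspace_Ker_diff_op:
  assumes "comm_alg scale" and "\<And>i. derivation scale (D i)"
  shows "module.subspace scale (Ker (diff_op P D))"
proof -
  interpret comm_alg scale by fact
  have "foldr D w 0 = 0" for w
    by (induction w) (simp_all add: derivation_0[OF assms(2)])
  moreover have "foldr D w (a + b) = foldr D w a + foldr D w b" for w a b
    by (induction w) (simp_all add: derivation_add[OF assms(2)])
  moreover have "foldr D w (scale r a) = scale r (foldr D w a)" for w r a
    by (induction w) (simp_all add: derivation_scale[OF assms(2)])
  moreover have "a * scale r b = scale r (a * b)" for r a b
    using scale_mult_left[of r b a] by (simp add: mult.commute)
  ultimately show ?thesis
    unfolding subspace_def Ker_def diff_op_def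
    by (simp add: distrib_left sum.distrib flip: scale_sum_right)
qed

lemma radical_Ker_diff_op_subset:
  assumes "\<And>i. derivation scale (D i)"
  shows "radical (Ker (diff_op P D)) \<subseteq> radical (Ann (Poly_Mapping.lookup P []))"
proof
  fix u assume "u \<in> radical (Ker (diff_op P D))"
  then obtain N where N: "\<And>m. m \<ge> N \<Longrightarrow> diff_op P D (u ^ m) = 0"
    by (auto simp: radical_def Ker_def)
  define e where "e = Max (length ` Poly_Mapping.keys P)"
  have e: "w \<in> Poly_Mapping.keys P \<Longrightarrow> length w \<le> e" for w
    unfolding e_def by (intro Max_ge) auto
  \<comment> \<open>Every positive power of \<open>t\<close> is a power of \<open>u\<close> with
    exponent at least \<open>N\<close>, so \<open>ad_funpow_one\<close> applies to
    \<open>t\<close>.\<close>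
  define t where "t = u ^ Suc N"
  have "diff_op P D (t ^ m) = 0" if "m \<ge> 1" for m
  proof -
    have "N \<le> Suc N * m"
      using that by (cases m) auto
    then show ?thesis
      using N by (simp only: t_def flip: power_mult)
  qed
  \<comment> \<open>Two values of the \<open>Suc e\<close>-fold commutator at \<open>1\<close> are
    compared: the one from \<open>ad_funpow_one\<close>, and \<open>0\<close> because no word is
    longer than \<open>e\<close>.\<close>
  then have "(- t) ^ Suc e * diff_op P D 1 = 0"
    using ad_funpow_one[of "diff_op P D" t "Suc e"] ad_funpow_diff_op(2)[OF assms e]
    by simp
  then have kill: "Poly_Mapping.lookup P [] * t ^ Suc e = 0"
    by (simp add: diff_op_1[OF assms] power_minus[of t] mult.commute minus_one_power_iff
        split: if_splits)
  have "Poly_Mapping.lookup P [] * u ^ m = 0" if "m \<ge> Suc N * Suc e" for m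
  proof -
    have "u ^ m = t ^ Suc e * u ^ (m - Suc N * Suc e)"
      using that unfolding t_def power_mult[symmetric] power_add[symmetric] by simp
    then show ?thesis
      using kill by (metis mult.assoc mult_zero_left)
  qed
  then show "u \<in> radical (Ann (Poly_Mapping.lookup P []))"
    by (auto simp: radical_def Ann_def)
qed

section \<open>Nilpotents, radicals and Mathieu subspaces\<close>

lemma power_eq_0_mono: "a ^ k = 0 \<Longrightarrow> k \<le> m \<Longrightarrow> a ^ m = (0::'a::comm_ring_1)"
  by (metis le_iff_add mult_zero_left power_add)

lemma zero_divisor_0: "zero_divisor (0::'a::comm_ring_1)"
  unfolding zero_divisor_def by (intro exI[of _ 1]) simp

lemma not_zero_divisorD: "\<not> zero_divisor a \<Longrightarrow> a * b = 0 \<Longrightarrow> b = 0"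
  by (auto simp: zero_divisor_def)

lemma radical_subset_nilpotents:
  assumes "\<not> zero_divisor a"
  shows "radical (Ann a) \<subseteq> nilpotents"
proof
  fix u assume "u \<in> radical (Ann a)"
  then obtain m where "a * u ^ m = 0"
    by (auto simp: radical_def Ann_def)
  then have "u ^ m = 0"
    by (rule not_zero_divisorD[OF assms])
  then show "u \<in> nilpotents"
    by (auto simp: nilpotents_def)
qed

lemma nilpotents_subset_radical:
  assumes "0 \<in> V"
  shows "nilpotents \<subseteq> radical V"
proof
  fix u :: 'a assume "u \<in> nilpotents"
  then obtain k where "u ^ k = 0"
    by (auto simp: nilpotents_def)
  then have "u ^ m \<in> V" if "m \<ge> k" for m
    using power_eq_0_mono[OF \<open>u ^ k = 0\<close> that] assms by simp
  then show "u \<in> radical V"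
    by (auto simp: radical_def)
qed

text \<open>An element all of whose positive powers lie in \<open>V\<close> is nilpotent, so
  \<open>b * a ^ m * c\<close> is eventually \<open>0\<close>.\<close>

lemma mathieu_subspaceI:
  assumes "comm_alg scale" "module.subspace scale V" "radical V \<subseteq> nilpotents"
  shows "mathieu_subspace scale V"
  unfolding mathieu_subspace_def
proof (intro conjI allI impI)
  interpret comm_alg scale by fact
  fix a b c assume "\<forall>m\<ge>1. a ^ m \<in> V"
  then have "a \<in> nilpotents"
    using assms(3) by (auto simp: radical_def)
  then obtain k where "a ^ k = 0"
    by (auto simp: nilpotents_def)
  then have "b * a ^ m * c \<in> V" if "m \<ge> k" for m
    using power_eq_0_mono[OF \<open>a ^ k = 0\<close> that] subspace_0[OF assms(2)] by simp
  then show "\<exists>N. \<forall>m\<ge>N. b * a ^ m * c \<in> V"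
    by blast
qed fact

section \<open>Homogeneous components and their symbols\<close>

lemma lookup_sum_homogeneous:
  assumes "\<And>k. k \<in> {1..d} \<Longrightarrow> nc_homogeneous k (Pk k)"
    and "P = nc_const a0 + (\<Sum>k = 1..d. Pk k)"
  shows "Poly_Mapping.lookup P w =
    (if w = [] then a0 else if length w \<le> d then Poly_Mapping.lookup (Pk (length w)) w else 0)"
proof -
  have "Poly_Mapping.lookup (Pk k) w = 0" if "k \<in> {1..d}" "k \<noteq> length w" for k
    using assms(1)[OF that(1)] that(2) by (auto simp: nc_homogeneous_def in_keys_iff)
  then have "(\<Sum>k = 1..d. Poly_Mapping.lookup (Pk k) w) =
      (\<Sum>k = 1..d. if k = length w then Poly_Mapping.lookup (Pk k) w else 0)"
    by (intro sum.cong) auto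
  then show ?thesis
    by (auto simp: assms(2) lookup_add lookup_sum nc_const_def lookup_single when_def
        Suc_le_eq)
qed

lemma nc_eval_homogeneous_component:
  assumes "\<And>w. length w = e \<Longrightarrow> Poly_Mapping.lookup Q w = Poly_Mapping.lookup P w"
    and "nc_homogeneous e Q"
  shows "nc_eval Q v = symbol_at e P v"
proof -
  have keys: "w \<in> Poly_Mapping.keys Q \<longleftrightarrow> w \<in> Poly_Mapping.keys P \<and> length w = e" for w
  proof (cases "length w = e")
    case True
    then show ?thesis
      using assms(1)[OF True] by (simp add: in_keys_iff)
  next
    case False
    then show ?thesis
      using assms(2) by (auto simp: nc_homogeneous_def)
  qed
  show ?thesis
    unfolding nc_eval_def symbol_at_def
    by (intro sum.cong) (use keys assms(1) in auto)
qed

text \<open>By the chain rule and homogeneity, the symbol at the gradient of \<open>u ^ m\<close> is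
  the symbol at the gradient of \<open>u\<close> times
  \<open>of_nat m ^ e * u ^ ((m - 1) * e)\<close>. For \<open>e \<ge> 1\<close> and
  \<open>m > N\<close> this exponent is at least \<open>N\<close>, so
  \<open>symbol_at_power_eq_0\<close> applies.\<close>

lemma radical_Ker_diff_op_subset_symbol:
  assumes "\<And>i. derivation scale (D i)"
    and "\<And>w. w \<in> Poly_Mapping.keys P \<Longrightarrow> length w \<le> e"
    and "e \<ge> 1"
  shows "radical (Ker (diff_op P D))
    \<subseteq> radical {u. of_nat (fact e) * symbol_at e P (gradient D u) = 0}"
proof
  fix u assume "u \<in> radical (Ker (diff_op P D))"
  then obtain N where N: "\<And>m. m \<ge> N \<Longrightarrow> u ^ m \<in> Ker (diff_op P D)"
    by (auto simp: radical_def)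
  have "of_nat (fact e) * symbol_at e P (gradient D (u ^ m)) = 0" if m: "m \<ge> Suc N" for m
  proof -
    have "N \<le> (m - 1) * e"
      using m assms(3) by (cases e) auto
    have zero: "of_nat (fact e) * symbol_at e P (gradient D u) * u ^ ((m - 1) * e) = 0"
      by (rule symbol_at_power_eq_0[OF assms(1,2) N \<open>N \<le> (m - 1) * e\<close>])
    have "of_nat (fact e) * symbol_at e P (gradient D (u ^ m)) =
        of_nat m ^ e * (of_nat (fact e) * symbol_at e P (gradient D u) * u ^ ((m - 1) * e))"
      unfolding gradient_power[OF assms(1)] symbol_at_scale
      by (simp add: power_mult_distrib ac_simps flip: power_mult)
    then show ?thesis
      by (simp only: zero mult_zero_right)
  qed
  then show "u \<in> radical {u. of_nat (fact e) * symbol_at e P (gradient D u) = 0}"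
    by (auto simp: radical_def)
qed

text \<open>With one variable there is a single word of each length; the nonzero leading coefficient
  puts it into the support.\<close>

lemma symbol_at_degree_single_variable:
  fixes i :: "'n::finite"
  assumes "CARD('n) = 1" and "nc_lead_coeff i P \<noteq> 0"
  shows "symbol_at (nc_degree P) P v = nc_lead_coeff i P * v i ^ nc_degree P"
proof -
  have "j = i" for j
    using assms(1) by (metis UNIV_I card_1_singletonE singletonD)
  then have "w = replicate (length w) i" for w
    by (simp add: replicate_eqI)
  then have "{w \<in> Poly_Mapping.keys P. length w = nc_degree P} = {replicate (nc_degree P) i}"
    using assms(2) by (auto simp: nc_lead_coeff_def in_keys_iff) metis
  then show ?thesis
    by (simp add: symbol_at_def nc_lead_coeff_def)
qed

theorem corollary2p5:
  fixes scale :: "'r::comm_ring_1 \<Rightarrow> 'a::comm_ring_1 \<Rightarrow> 'a"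
    and D :: "'n::finite \<Rightarrow> 'a \<Rightarrow> 'a"
    and P :: "('n, 'a) ncpoly"
    and Pk :: "nat \<Rightarrow> ('n, 'a) ncpoly"
    and a0 :: 'a
    and d :: nat
  assumes "comm_alg scale"
    and "\<And>i. derivation scale (D i)"
    and "P \<noteq> 0"
    and "d \<ge> 1"
    and "\<And>k. k \<in> {1..d} \<Longrightarrow> nc_homogeneous k (Pk k)"
    and "P = nc_const a0 + (\<Sum>k = 1..d. Pk k)"
  shows "radical (Ker (diff_op P D)) \<subseteq> radical (Ann a0)
    \<and> (a0 \<noteq> 0 \<and> \<not> zero_divisor a0 \<longrightarrow>
         radical (Ker (diff_op P D)) = nilpotents \<and> mathieu_subspace scale (Ker (diff_op P D)))
    \<and> (a0 = 0 \<longrightarrow>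
         radical (Ker (diff_op P D))
           \<subseteq> radical {u. of_nat (fact d) * nc_eval (Pk d) (gradient D u) = 0})
    \<and> (a0 = 0 \<and> CARD('n) = 1 \<longrightarrow>
         (\<forall>i. \<not> zero_divisor (nc_lead_coeff i P) \<longrightarrow>
           radical (Ker (diff_op P D)) \<subseteq> radical {u. of_nat (fact d) * D i u \<in> nilpotents}))"
proof -
  note deriv = assms(2)
  have lookup_P: "Poly_Mapping.lookup P w = (if w = [] then a0
      else if length w \<le> d then Poly_Mapping.lookup (Pk (length w)) w else 0)" for w
    using assms(5,6) by (rule lookup_sum_homogeneous)
  have length_le: "length w \<le> d" if "w \<in> Poly_Mapping.keys P" for w
    using that by (auto simp: in_keys_iff lookup_P split: if_splits)
  have part1: "radical (Ker (diff_op P D)) \<subseteq> radical (Ann a0)"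
    using radical_Ker_diff_op_subset[OF deriv, of P] lookup_P[of "[]"] by simp
  have part2: "radical (Ker (diff_op P D)) = nilpotents"
    "mathieu_subspace scale (Ker (diff_op P D))" if "\<not> zero_divisor a0"
  proof -
    have sub: "module.subspace scale (Ker (diff_op P D))"
      by (rule subspace_Ker_diff_op[OF assms(1) deriv])
    have nil: "radical (Ker (diff_op P D)) \<subseteq> nilpotents"
      using part1 radical_subset_nilpotents[OF that] by blast
    show "mathieu_subspace scale (Ker (diff_op P D))"
      by (rule mathieu_subspaceI[OF assms(1) sub nil])
    interpret comm_alg scale by fact
    show "radical (Ker (diff_op P D)) = nilpotents"
      using nil nilpotents_subset_radical[OF subspace_0[OF sub]] by blast
  qed
  have part3: "radical (Ker (diff_op P D))
      \<subseteq> radical {u. of_nat (fact d) * nc_eval (Pk d) (gradient D u) = 0}"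
  proof -
    \<comment> \<open>Since \<open>d \<ge> 1\<close>, a word of length \<open>d\<close> is nonempty,
      so its coefficient in \<open>P\<close> comes from \<open>Pk d\<close>.\<close>
    have "nc_eval (Pk d) v = symbol_at d P v" for v
      using assms(4,5) by (intro nc_eval_homogeneous_component) (auto simp: lookup_P)
    then show ?thesis
      using radical_Ker_diff_op_subset_symbol[OF deriv length_le assms(4)] by simp
  qed
  have part4: "radical (Ker (diff_op P D)) \<subseteq> radical {u. of_nat (fact d) * D i u \<in> nilpotents}"
    if "a0 = 0" "CARD('n) = 1" and lc: "\<not> zero_divisor (nc_lead_coeff i P)" for i
  proof -
    \<comment> \<open>\<open>Pk d\<close> may be zero, so the argument uses the true degree
      \<open>e\<close>; \<open>a0 = 0\<close> forces \<open>e \<ge> 1\<close>.\<close>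
    define e where "e = nc_degree P"
    have lc0: "nc_lead_coeff i P \<noteq> 0"
      using lc zero_divisor_0 by metis
    then have "replicate e i \<in> Poly_Mapping.keys P"
      by (simp add: nc_lead_coeff_def in_keys_iff e_def)
    then have e: "1 \<le> e" "e \<le> d"
      using length_le[of "replicate e i"] lookup_P[of "[]"] \<open>a0 = 0\<close>
      by (cases e; auto simp: in_keys_iff)+
    have length_le_e: "length w \<le> e" if "w \<in> Poly_Mapping.keys P" for w
      using that unfolding e_def nc_degree_def by (intro Max_ge) auto
    have "of_nat (fact d) * D i u \<in> nilpotents"
      if "of_nat (fact e) * symbol_at e P (gradient D u) = 0" for u
    proof -
      have "nc_lead_coeff i P * (of_nat (fact e) * D i u ^ e) = 0"
        using that symbol_at_degree_single_variable[OF \<open>CARD('n) = 1\<close> lc0]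
        by (simp add: gradient_def e_def ac_simps)
      then have zero: "of_nat (fact e) * D i u ^ e = 0"
        by (rule not_zero_divisorD[OF lc])
      \<comment> \<open>As \<open>1 \<le> e \<le> d\<close>, this divisibility turns the vanishing
        of \<open>of_nat (fact e) * D i u ^ e\<close> into that of the \<open>e\<close>-th power of
        \<open>of_nat (fact d) * D i u\<close>.\<close>
      have "fact e dvd (fact d :: nat) ^ e"
        using e fact_dvd[of e d] by (metis dvd_power dvd_trans less_eq_Suc_le One_nat_def)
      then obtain q where "(fact d :: nat) ^ e = q * fact e"
        by (metis dvdE mult.commute)
      then have "(of_nat (fact d) :: 'a) ^ e = of_nat q * of_nat (fact e)"
        by (metis of_nat_mult of_nat_power)
      then have "(of_nat (fact d) * D i u) ^ e = of_nat q * (of_nat (fact e) * D i u ^ e)"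
        by (simp only: power_mult_distrib mult.assoc)
      then show ?thesis
        unfolding nilpotents_def zero by auto
    qed
    then have "radical {u. of_nat (fact e) * symbol_at e P (gradient D u) = 0}
        \<subseteq> radical {u. of_nat (fact d) * D i u \<in> nilpotents}"
      unfolding radical_def by blast
    then show ?thesis
      using radical_Ker_diff_op_subset_symbol[of scale D P e, OF deriv length_le_e e(1)]
      by (rule order_trans[rotated]) simp_all
  qed
  show ?thesis
    by (intro conjI impI allI part1 part2 part3 part4; (elim conjE)?; assumption)
qed

end
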